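(* For every $\epsilon>0$ and $c\ge 1$ there is a constant $C(\epsilon,c)$ such that the following holds. Let $N=2l+1\ge 3$ be odd, let $V_N=\mathbb Z/N\mathbb Z$ be the vertex set of the circle graph on $N$ vertices, and let $K$ be the Markov kernel on $V_N$ given by $$K(x,y)=\begin{cases}0,&\text{if } |x-y|\ne 1,\\ 1/2,&\text{if } |x-y|=1\text{ and }x\notin\{0,1\},\\ (1+\epsilon)/(2+\epsilon),&\text{if }(x,y)\in\{(0,1),(1,0)\},\\ 1/(2+\epsilon),&\text{if }(x,y)\in\{(0,-1),(1,2)\}.\end{cases}$$ Let $g$ be a permutation of $V_N$, let $K_i(x,y)=K(g^{i-1}x,g^{i-1}y)$ for $i=1,2,\dots$, let $\widetilde K(x,y)=K(x,g^{-1}y)$, and let $\widetilde\pi$ be an invariant probability measure of $\widetilde K$. Assume that $$\max_{x\in V_N}\{\widetilde\pi(x)\}\le c\min_{x\in V_N}\{\widetilde\pi(x)\}.$$ Then for all $\eta>0$ the relative-sup merging time of $(K_i)_1^\infty$ satisfies $$T_\infty(\eta)\le C(\epsilon,c)\,N^2\,(1+\log_+ (1/\eta)).$$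
   Context: Elements of $\mathbb Z/N\mathbb Z$ are added modulo $N$; $|x-y|=1$ means $x-y\equiv\pm1 \pmod N$, i.e. $x,y$ are neighbors on the circle graph. For a sequence $(K_i)_1^\infty$ of Markov kernels on a finite set $V$, $K_{0,n}=K_1K_2\cdots K_n$ (matrix product). For $\eta>0$ the $\eta$ relative-sup merging time is $$T_\infty(\eta)=\min\left\{n:\max_{x,y,z\in V}\left|\frac{K_{0,n}(x,z)}{K_{0,n}(y,z)}-1\right|<\eta\right\},$$ where the maximum is taken to be $+\infty$ if some $K_{0,n}(y,z)=0$. Also $\log_+ t=\max\{\log t,0\}$. The constant $C(\epsilon,c)$ does not depend on $N$, $g$ or $\eta$. *)

theory Defs
  imports
    Complex_Main
    "HOL-Library.Extended_Real"
    "HOL-Combinatorics.Permutations"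
    "HOL-Number_Theory.Cong"
begin

text \<open>
  A kernel on a finite set \<open>V\<close> is a function \<open>'a \<Rightarrow> 'a \<Rightarrow> real\<close>, of which only the values
  on \<open>V \<times> V\<close> matter. A sequence of kernels \<open>K 1, K 2, \<dots>\<close> is a function on \<^typ>\<open>nat\<close> whose
  value at \<open>0\<close> is ignored.
\<close>

type_synonym 'a kernel = "'a \<Rightarrow> 'a \<Rightarrow> real"

definition kernel_mult :: "'a set \<Rightarrow> 'a kernel \<Rightarrow> 'a kernel \<Rightarrow> 'a kernel" where
  "kernel_mult V P Q x z = (\<Sum>y\<in>V. P x y * Q y z)"

fun kernel_prod :: "'a set \<Rightarrow> (nat \<Rightarrow> 'a kernel) \<Rightarrow> nat \<Rightarrow> 'a kernel" where
  "kernel_prod V K 0 = (\<lambda>x y. if x = y then 1 else 0)"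
| "kernel_prod V K (Suc n) = kernel_mult V (kernel_prod V K n) (K (Suc n))"

definition invariant_prob :: "'a set \<Rightarrow> 'a kernel \<Rightarrow> ('a \<Rightarrow> real) \<Rightarrow> bool" where
  "invariant_prob V P \<pi> \<longleftrightarrow>
     (\<forall>x\<in>V. 0 \<le> \<pi> x) \<and> (\<Sum>x\<in>V. \<pi> x) = 1 \<and> (\<forall>y\<in>V. (\<Sum>x\<in>V. \<pi> x * P x y) = \<pi> y)"

definition rel_sup_dist :: "'a set \<Rightarrow> 'a kernel \<Rightarrow> ereal" where
  "rel_sup_dist V P =
     (if \<exists>y\<in>V. \<exists>z\<in>V. P y z = 0 then \<infinity>
      else ereal (Max {\<bar>P x z / P y z - 1\<bar> | x y z. x \<in> V \<and> y \<in> V \<and> z \<in> V}))"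

text \<open>The infimum of the empty set is \<open>\<infinity>\<close>: the time is infinite if merging never occurs.\<close>

definition rel_sup_merging_time :: "'a set \<Rightarrow> (nat \<Rightarrow> 'a kernel) \<Rightarrow> real \<Rightarrow> enat" where
  "rel_sup_merging_time V K \<eta> =
     Inf {enat n | n. rel_sup_dist V (kernel_prod V K n) < ereal \<eta>}"

definition log_plus :: "real \<Rightarrow> real" where
  "log_plus t = max (ln t) 0"

text \<open>\<open>\<int>/N\<int>\<close> is represented by the residues \<open>0, \<dots>, N - 1\<close>.\<close>

definition circle_verts :: "int \<Rightarrow> int set" where
  "circle_verts N = {0..<N}"

definition circle_adj :: "int \<Rightarrow> int \<Rightarrow> int \<Rightarrow> bool" where
  "circle_adj N x y \<longleftrightarrow> [x - y = 1] (mod N) \<or> [x - y = -1] (mod N)"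

text \<open>For \<open>N \<ge> 3\<close> the cases below are exhaustive on the vertices; the final \<open>0\<close> is never reached.\<close>

definition circle_kernel :: "real \<Rightarrow> int \<Rightarrow> int kernel" where
  "circle_kernel \<epsilon> N x y =
     (if \<not> circle_adj N x y then 0
      else if x \<notin> {0, 1} then 1 / 2
      else if (x, y) \<in> {(0, 1), (1, 0)} then (1 + \<epsilon>) / (2 + \<epsilon>)
      else if (x, y) \<in> {(0, -1 mod N), (1, 2)} then 1 / (2 + \<epsilon>)
      else 0)"

end

theory Submission
  imports Defs "HOL-Analysis.Convex" "HOL-Combinatorics.Cycles"
begin

text \<open>
  Since \<open>K\<^bsub>0,n\<^esub>(x, y) = P\<^sup>n(x, g\<^sup>n y)\<close> for the homogeneous kernel \<open>P(x, y) = K(x, g\<^sup>-\<^sup>1 y)\<close>, it suffices to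
  study the powers of \<open>P\<close>, whose invariant measure \<open>\<pi>\<close> is comparable to the uniform one. One step
  of \<open>P\<close> lowers \<open>\<parallel>f\<parallel>\<^sup>2\<close> in \<open>L\<^sup>2(\<pi>)\<close> by the \<open>\<pi>\<close>-average of the variances of \<open>f\<close> under the rows of \<open>P\<close>.
  The row of \<open>x\<close> charges \<open>g(x + 1)\<close> and \<open>g(x - 1)\<close>, and because \<open>N\<close> is odd these pairs link all
  vertices into one cycle; the same holds for the time reversal of \<open>P\<close>, with \<open>x + 1\<close> and \<open>x - 1\<close> in the
  row of \<open>g x\<close>. The one-dimensional Nash inequality along the cycle brings the \<open>\<chi>\<^sup>2\<close>-distance below \<open>1\<close>
  after \<open>O(N\<^sup>2)\<close> steps, without the factor \<open>log N\<close> that a spectral gap alone would cost, and the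
  spectral gap makes it decay exponentially from then on. Pairing the densities of \<open>P\<^sup>k\<close> and of its
  reversal turns the \<open>L\<^sup>2\<close> bounds into a uniform bound on the density of \<open>P\<^sup>2\<^sup>k\<close>.
\<close>

section \<open>Nash inequality on a path\<close>

lemma abs_diff_le_path_variation:
  fixes f :: "nat \<Rightarrow> real"
  assumes "i < n" and "j < n"
  shows "\<bar>f i - f j\<bar> \<le> (\<Sum>k<n-1. \<bar>f (Suc k) - f k\<bar>)"
proof -
  have *: "\<bar>f j - f i\<bar> \<le> (\<Sum>k<n-1. \<bar>f (Suc k) - f k\<bar>)" if "i \<le> j" "j < n" for i j
  proof -
    have "\<bar>f j - f i\<bar> = \<bar>\<Sum>k=i..<j. f (Suc k) - f k\<bar>"
      using that by (simp add: sum_Suc_diff')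
    also have "\<dots> \<le> (\<Sum>k=i..<j. \<bar>f (Suc k) - f k\<bar>)"
      by (rule sum_abs)
    also have "\<dots> \<le> (\<Sum>k<n-1. \<bar>f (Suc k) - f k\<bar>)"
      using that by (intro sum_mono2) auto
    finally show ?thesis .
  qed
  show ?thesis
    using *[of i j] *[of j i] assms by (cases "i \<le> j") (auto simp: abs_minus_commute)
qed

lemma signed_square_diff_le:
  fixes a b :: real
  shows "\<bar>\<bar>a\<bar> * a - \<bar>b\<bar> * b\<bar> \<le> \<bar>a - b\<bar> * (\<bar>a\<bar> + \<bar>b\<bar>)"
proof -
  have "\<bar>a - b\<bar> * (\<bar>a\<bar> + \<bar>b\<bar>) = \<bar>(a - b) * (\<bar>a\<bar> + \<bar>b\<bar>)\<bar>"
    by (simp add: abs_mult)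
  moreover have "a * b \<le> 0 \<or> a * b \<ge> 0"
    by linarith
  ultimately show ?thesis
    by (auto simp: abs_if algebra_simps mult_nonneg_nonneg mult_nonpos_nonpos
        mult_nonneg_nonpos mult_nonpos_nonneg split: if_splits)
      (smt (verit) mult_nonneg_nonpos mult_nonpos_nonneg mult_neg_neg mult_nonneg_nonneg)+
qed

text \<open>The sign change bounds every squared value by the variation \<open>T\<close> of the
  signed square. Cauchy-Schwarz gives \<open>T * T \<le> 4 * D * S\<close>, while sup norm times L1
  norm gives \<open>S \<le> sqrt T * A\<close>; the fourth power of the latter, divided by
  \<open>S\<close>, is the claim. Asking for sign changes rather than a zero sum lets the mean
  vanish with respect to any positive weight.\<close>

lemma nash_inequality_path:
  fixes f :: "nat \<Rightarrow> real"
  assumes sign_change: "\<And>i. i < n \<Longrightarrow> \<exists>j<n. f i * f j \<le> 0"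
  shows "(\<Sum>i<n. (f i)\<^sup>2) ^ 3 \<le>
    4 * (\<Sum>i<n-1. (f (Suc i) - f i)\<^sup>2) * (\<Sum>i<n. \<bar>f i\<bar>) ^ 4"
proof -
  define S D A where "S = (\<Sum>i<n. (f i)\<^sup>2)" and "D = (\<Sum>i<n-1. (f (Suc i) - f i)\<^sup>2)"
    and "A = (\<Sum>i<n. \<bar>f i\<bar>)"
  define T where "T = (\<Sum>i<n-1. \<bar>f (Suc i) - f i\<bar> * (\<bar>f (Suc i)\<bar> + \<bar>f i\<bar>))"
  have nonneg: "S \<ge> 0" "D \<ge> 0" "A \<ge> 0" "T \<ge> 0"
    by (auto simp: S_def D_def A_def T_def intro!: sum_nonneg)
  have sq_le: "(f i)\<^sup>2 \<le> T" if i: "i < n" for i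
  proof -
    \<comment> \<open>The signed square is increasing, so opposite signs of \<open>f i\<close> and
      \<open>f j\<close> put zero between \<open>s i\<close> and \<open>s j\<close>; their distance
      is then at least the square of \<open>f i\<close>.\<close>
    define s where "s k = \<bar>f k\<bar> * f k" for k
    obtain j where j: "j < n" "f i * f j \<le> 0"
      using sign_change[OF i] by blast
    have "(f i)\<^sup>2 \<le> \<bar>s i - s j\<bar>"
    proof (cases "f i \<ge> 0")
      case True
      then have "f i = 0 \<or> s j \<le> 0"
        using j(2) by (auto simp: s_def mult_le_0_iff)
      then show ?thesis
        using True by (auto simp: s_def power2_eq_square)
    next
      case False
      then have "s j \<ge> 0"
        using j(2) by (auto simp: s_def mult_le_0_iff)
      then show ?thesis
        using False by (auto simp: s_def power2_eq_square)
    qed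
    also have "\<dots> \<le> (\<Sum>k<n-1. \<bar>s (Suc k) - s k\<bar>)"
      using i j(1) by (rule abs_diff_le_path_variation)
    also have "\<dots> \<le> T"
      unfolding T_def s_def by (intro sum_mono signed_square_diff_le)
    finally show ?thesis .
  qed
  have "(\<Sum>i<n-1. (f (Suc i))\<^sup>2) \<le> S"
  proof -
    have "(\<Sum>i<n-1. (f (Suc i))\<^sup>2) = (\<Sum>i\<in>Suc ` {..<n-1}. (f i)\<^sup>2)"
      by (simp add: sum.reindex)
    also have "\<dots> \<le> S"
      unfolding S_def by (intro sum_mono2) auto
    finally show ?thesis .
  qed
  moreover have "(\<Sum>i<n-1. (f i)\<^sup>2) \<le> S"
    unfolding S_def by (intro sum_mono2) auto
  moreover have "(\<bar>a\<bar> + \<bar>b\<bar>)\<^sup>2 \<le> 2 * a\<^sup>2 + 2 * b\<^sup>2" for a b :: real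
    using zero_le_power2[of "\<bar>a\<bar> - \<bar>b\<bar>"] by (simp add: power2_eq_square algebra_simps)
  then have "(\<Sum>i<n-1. (\<bar>f (Suc i)\<bar> + \<bar>f i\<bar>)\<^sup>2) \<le> (\<Sum>i<n-1. 2 * (f (Suc i))\<^sup>2 + 2 * (f i)\<^sup>2)"
    by (intro sum_mono) auto
  ultimately have "(\<Sum>i<n-1. (\<bar>f (Suc i)\<bar> + \<bar>f i\<bar>)\<^sup>2) \<le> 4 * S"
    by (simp add: sum.distrib flip: sum_distrib_left)
  then have "D * (\<Sum>i<n-1. (\<bar>f (Suc i)\<bar> + \<bar>f i\<bar>)\<^sup>2) \<le> D * (4 * S)"
    by (intro mult_left_mono nonneg)
  moreover have "T\<^sup>2 \<le> D * (\<Sum>i<n-1. (\<bar>f (Suc i)\<bar> + \<bar>f i\<bar>)\<^sup>2)"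
    unfolding T_def D_def
    using Cauchy_Schwarz_ineq_sum[of "\<lambda>i. \<bar>f (Suc i) - f i\<bar>" "\<lambda>i. \<bar>f (Suc i)\<bar> + \<bar>f i\<bar>" "{..<n-1}"]
    by simp
  ultimately have T2: "T\<^sup>2 \<le> 4 * D * S"
    by simp
  have "S \<le> sqrt T * A"
    unfolding S_def A_def sum_distrib_left
  proof (rule sum_mono)
    fix i assume "i \<in> {..<n}"
    then have "\<bar>f i\<bar> \<le> sqrt T"
      using sq_le[of i] real_le_rsqrt[of "\<bar>f i\<bar>" T] by simp
    then show "(f i)\<^sup>2 \<le> sqrt T * \<bar>f i\<bar>"
      using mult_right_mono[of "\<bar>f i\<bar>" "sqrt T" "\<bar>f i\<bar>"] by (simp add: power2_eq_square)
  qed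
  then have "S ^ 4 \<le> (sqrt T * A) ^ 4"
    using nonneg by (intro power_mono)
  also have "(sqrt T * A) ^ 4 = T\<^sup>2 * A ^ 4"
  proof -
    have "sqrt T ^ 4 = ((sqrt T)\<^sup>2)\<^sup>2"
      by simp
    then show ?thesis
      using nonneg by (simp add: power_mult_distrib)
  qed
  also have "\<dots> \<le> 4 * D * S * A ^ 4"
    by (intro mult_right_mono T2) auto
  finally have "S * S ^ 3 \<le> S * (4 * D * A ^ 4)"
    by (simp add: power_numeral_reduce algebra_simps)
  moreover have "S ^ 3 \<le> 4 * D * A ^ 4" if "S = 0"
    using that nonneg by simp
  ultimately have "S ^ 3 \<le> 4 * D * A ^ 4"
    using nonneg(1) by (cases "S = 0") (auto simp: mult_le_cancel_left)
  then show ?thesis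
    by (simp add: S_def D_def A_def)
qed

section \<open>Decay of a scalar recursion\<close>

text \<open>Averaging the linear and cubic decrements yields a quadratic one, under which
  \<open>1 / a\<close> grows by at least \<open>r\<close> per step. Hence \<open>a\<close> drops
  below one within about \<open>1 / r\<close> steps whatever \<open>a 0\<close> is, and the linear
  decrement then gives exponential decay. The independence of \<open>a 0\<close> is what avoids a
  logarithm of the number of states.\<close>

lemma cubic_then_exponential_decay:
  fixes a :: "nat \<Rightarrow> real"
  assumes nonneg: "\<And>n. 0 \<le> a n"
    and linear: "\<And>n. a (Suc n) \<le> a n - r * a n"
    and cubic: "\<And>n. a (Suc n) \<le> a n - r * a n ^ 3"
    and r: "0 < r" "r \<le> 1" and "0 \<le> L" and n: "(2 + L) / r \<le> real n"
  shows "a n \<le> exp (- L)"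
proof -
  have quadratic: "a (Suc n) \<le> a n - r * (a n)\<^sup>2" for n
  proof -
    have "0 \<le> a n * (a n - 1)\<^sup>2"
      using nonneg by simp
    then have "2 * (a n)\<^sup>2 \<le> a n + a n ^ 3"
      by (simp add: power2_eq_square power3_eq_cube algebra_simps)
    then have "r * (2 * (a n)\<^sup>2) \<le> r * (a n + a n ^ 3)"
      using r by (intro mult_left_mono) auto
    with linear[of n] cubic[of n] show ?thesis
      by (simp add: algebra_simps)
  qed
  have dec: "a (Suc n) \<le> a n" for n
    using linear[of n] nonneg[of n] r by (smt (verit) mult_nonneg_nonneg)
  have inv_growth: "r * real k * a k \<le> 1" for k
  proof (induction k)
    case 0
    then show ?case by simp
  next
    case (Suc k)
    show ?case
    proof (cases "a k = 0")
      case True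
      then have "a (Suc k) = 0"
        using dec[of k] nonneg[of "Suc k"] by simp
      then show ?thesis by simp
    next
      case False
      then have pos: "a k > 0"
        using nonneg[of k] by simp
      \<comment> \<open>This is the growth of \<open>1 / a\<close> by \<open>r\<close>, multiplied
        out because \<open>a (Suc k)\<close> may vanish.\<close>
      have "a (Suc k) * (1 + r * a k) \<le> (a k - r * (a k)\<^sup>2) * (1 + r * a k)"
        using quadratic[of k] pos r by (intro mult_right_mono) auto
      also have "\<dots> = a k * (1 - (r * a k)\<^sup>2)"
        by (simp add: algebra_simps power2_eq_square)
      also have "\<dots> \<le> a k"
        using pos by (simp add: mult_le_cancel_left1)
      finally have "a (Suc k) * (1 + r * a k) \<le> a k" .
      moreover have "a (Suc k) * (r * real k * a k + r * a k) \<le> a (Suc k) * (1 + r * a k)"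
        using Suc nonneg by (intro mult_left_mono) auto
      ultimately have "a k * (r * real (Suc k) * a (Suc k)) \<le> a k * 1"
        by (simp add: algebra_simps)
      then show ?thesis
        using pos by (simp only: mult_le_cancel_left_pos)
    qed
  qed
  define n0 where "n0 = nat \<lceil>1 / r\<rceil>"
  have n0: "1 / r \<le> real n0" "real n0 \<le> 1 / r + 1"
    using r by (auto simp: n0_def of_nat_ceiling)
  have "a n0 \<le> r * real n0 * a n0"
  proof -
    have "1 \<le> r * real n0"
      using n0(1) r by (simp add: field_simps)
    then show ?thesis
      using nonneg[of n0] mult_right_mono[of 1 "r * real n0" "a n0"] by simp
  qed
  also have "\<dots> \<le> 1"
    by (rule inv_growth)
  finally have start: "a n0 \<le> 1" .
  have expo: "a (n0 + j) \<le> exp (- r * real j)" for j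
  proof (induction j)
    case 0
    then show ?case using start by simp
  next
    case (Suc j)
    have "a (n0 + Suc j) \<le> a (n0 + j) * (1 - r)"
      using linear[of "n0 + j"] by (simp add: algebra_simps)
    also have "\<dots> \<le> exp (- r * real j) * exp (- r)"
      using Suc r nonneg by (intro mult_mono exp_minus_ge) auto
    finally show ?case
      by (simp add: algebra_simps flip: exp_add)
  qed
  have L: "L / r \<le> real n - real n0"
  proof -
    \<comment> \<open>The waiting time \<open>n0\<close> is at most \<open>1 / r + 1\<close>, hence
      at most \<open>2 / r\<close>; this is the 2 in the hypothesis on \<open>n\<close>.\<close>
    have "(2 + L) / r = 2 * (1 / r) + L / r"
      by (simp add: add_divide_distrib)
    moreover have "1 \<le> 1 / r"
      using r by simp
    ultimately show ?thesis
      using n n0(2) by linarith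
  qed
  moreover have "0 \<le> L / r"
    using \<open>0 \<le> L\<close> r by simp
  ultimately have "n0 \<le> n"
    by linarith
  then have "a n \<le> exp (- r * (real n - real n0))"
    using expo[of "n - n0"] by (simp add: of_nat_diff)
  also have "\<dots> \<le> exp (- L)"
    using L r by (simp add: field_simps)
  finally show ?thesis .
qed

section \<open>Variance, stationary chains and time reversal\<close>

text \<open>The variance is half the sum of \<open>q x * q y * (f x - f y)\<^sup>2\<close> over
  ordered pairs; only the pairs (a,b) and (b,a) are kept. The case \<open>a = b\<close> is the
  nonnegativity of the variance.\<close>

lemma weighted_variance_ge:
  fixes q f :: "'a \<Rightarrow> real"
  assumes "finite V" and nonneg: "\<And>x. x \<in> V \<Longrightarrow> 0 \<le> q x" and one: "sum q V = 1"
    and ab: "a \<in> V" "b \<in> V"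
  shows "q a * q b * (f a - f b)\<^sup>2 \<le> (\<Sum>x\<in>V. q x * (f x)\<^sup>2) - (\<Sum>x\<in>V. q x * f x)\<^sup>2"
proof (cases "a = b")
  case True
  define m where "m = (\<Sum>x\<in>V. q x * f x)"
  have "0 \<le> (\<Sum>x\<in>V. q x * (f x - m)\<^sup>2)"
    using nonneg by (intro sum_nonneg) auto
  also have "\<dots> = (\<Sum>x\<in>V. q x * (f x)\<^sup>2) - 2 * m * (\<Sum>x\<in>V. q x * f x) + m\<^sup>2 * (\<Sum>x\<in>V. q x)"
    by (simp add: power2_eq_square algebra_simps sum.distrib sum_subtractf sum_distrib_left)
  finally show ?thesis
    using True one by (simp add: m_def power2_eq_square)
next
  case False
  let ?h = "\<lambda>x y. q x * q y * (f x - f y)\<^sup>2"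
  have "2 * ?h a b = (\<Sum>(x,y)\<in>{(a,b),(b,a)}. ?h x y)"
    using False by (simp add: power2_commute mult.commute)
  also have "\<dots> \<le> (\<Sum>(x,y)\<in>V \<times> V. ?h x y)"
    using assms by (intro sum_mono2) (auto intro!: mult_nonneg_nonneg)
  also have "\<dots> = (\<Sum>x\<in>V. \<Sum>y\<in>V. (q x * (f x)\<^sup>2) * q y + q x * (q y * (f y)\<^sup>2)
      - 2 * ((q x * f x) * (q y * f y)))"
    by (simp add: sum.cartesian_product power2_eq_square algebra_simps)
  also have "\<dots> = 2 * ((\<Sum>x\<in>V. q x * (f x)\<^sup>2) - (\<Sum>x\<in>V. q x * f x)\<^sup>2)"
    by (simp add: sum.distrib sum_subtractf one power2_eq_square
        flip: sum_distrib_left sum_distrib_right)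
  finally show ?thesis
    by simp
qed

locale stationary_chain =
  fixes V :: "'a set" and P :: "'a kernel" and \<pi> :: "'a \<Rightarrow> real"
  assumes finite_V: "finite V"
    and nonneg: "\<And>x y. x \<in> V \<Longrightarrow> y \<in> V \<Longrightarrow> 0 \<le> P x y"
    and stochastic: "\<And>x. x \<in> V \<Longrightarrow> (\<Sum>y\<in>V. P x y) = 1"
    and pos: "\<And>x. x \<in> V \<Longrightarrow> 0 < \<pi> x"
    and invariant: "invariant_prob V P \<pi>"
begin

definition apply_kernel :: "('a \<Rightarrow> real) \<Rightarrow> 'a \<Rightarrow> real" where
  "apply_kernel f x = (\<Sum>y\<in>V. P x y * f y)"

lemma sum_apply_kernel: "(\<Sum>x\<in>V. \<pi> x * apply_kernel f x) = (\<Sum>x\<in>V. \<pi> x * f x)"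
proof -
  have "(\<Sum>x\<in>V. \<pi> x * apply_kernel f x) = (\<Sum>y\<in>V. (\<Sum>x\<in>V. \<pi> x * P x y) * f y)"
    unfolding apply_kernel_def sum_distrib_left sum_distrib_right
    by (subst sum.swap) (simp add: mult.assoc)
  then show ?thesis
    using invariant by (simp add: invariant_prob_def)
qed

lemma sum_stationary: "(\<Sum>x\<in>V. \<pi> x) = 1"
  using invariant by (simp add: invariant_prob_def)

lemma apply_kernel_diff_const:
  assumes "x \<in> V"
  shows "apply_kernel (\<lambda>y. f y - k) x = apply_kernel f x - k"
  using stochastic[OF assms]
  by (simp add: apply_kernel_def right_diff_distrib sum_subtractf flip: sum_distrib_right)

lemma stationary_nonneg: "x \<in> V \<Longrightarrow> 0 \<le> \<pi> x"
  using pos[of x] by simp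

text \<open>The adjoint of \<open>P\<close> in L2 of \<open>\<pi>\<close>. Densities with respect to
  \<open>\<pi>\<close> of the laws of the chain evolve under it.\<close>

definition reversal :: "'a kernel" where
  "reversal x y = \<pi> y * P y x / \<pi> x"

lemma stationary_chain_reversal: "stationary_chain V reversal \<pi>"
proof
  show "finite V"
    by (rule finite_V)
  show "0 \<le> reversal x y" if "x \<in> V" "y \<in> V" for x y
    using that nonneg pos[of x] pos[of y] by (simp add: reversal_def)
  show "(\<Sum>y\<in>V. reversal x y) = 1" if "x \<in> V" for x
    using that invariant pos[of x]
    by (simp add: reversal_def invariant_prob_def flip: sum_divide_distrib)
  show "0 < \<pi> x" if "x \<in> V" for x
    using that by (rule pos)
  have "(\<Sum>x\<in>V. \<pi> x * reversal x y) = \<pi> y" if "y \<in> V" for y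
  proof -
    have "(\<Sum>x\<in>V. \<pi> x * reversal x y) = (\<Sum>x\<in>V. \<pi> y * P y x)"
      using pos by (intro sum.cong) (auto simp: reversal_def dest!: pos)
    then show ?thesis
      using stochastic[OF that] by (simp flip: sum_distrib_left)
  qed
  then show "invariant_prob V reversal \<pi>"
    using invariant by (simp add: invariant_prob_def)
qed

end

section \<open>Contraction in L2 along a bridged path\<close>

text \<open>
  The states are enumerated as a path \<open>e 0, \<dots>, e (n - 1)\<close>, and from the state \<open>m i\<close> the chain can
  jump to both \<open>e i\<close> and \<open>e (i + 1)\<close>. A step of the chain therefore averages out differences along
  edges of the path, even though the chain itself need not move along them.
\<close>

locale path_bridged_chain = stationary_chain +
  fixes e m :: "nat \<Rightarrow> 'a" and n :: nat and p c :: real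
  assumes path: "bij_betw e {..<n} V"
    and bridge_inj: "inj_on m {..<n-1}"
    and bridge_mem: "m ` {..<n-1} \<subseteq> V"
    and bridge: "\<And>i. Suc i < n \<Longrightarrow> p \<le> P (m i) (e i)" "\<And>i. Suc i < n \<Longrightarrow> p \<le> P (m i) (e (Suc i))"
    and p: "0 < p" "p \<le> 1"
    and balanced: "\<And>x y. x \<in> V \<Longrightarrow> y \<in> V \<Longrightarrow> \<pi> x \<le> c * \<pi> y"
begin

lemma n_pos: "0 < n"
proof (rule ccontr)
  assume "\<not> 0 < n"
  then have "V = {}"
    using path by (simp add: bij_betw_def)
  then show False
    using sum_stationary by simp
qed

lemma e_mem: "i < n \<Longrightarrow> e i \<in> V"
  using path by (auto simp: bij_betw_def)

lemma sum_path: "(\<Sum>i<n. f (e i)) = (\<Sum>x\<in>V. f x)"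
  by (rule sum.reindex_bij_betw[OF path])

lemma c_ge_1: "1 \<le> c"
  using balanced[of "e 0" "e 0"] pos[of "e 0"] e_mem n_pos by simp

lemma stationary_le:
  assumes "x \<in> V"
  shows "\<pi> x \<le> c / real n"
proof -
  have "(\<Sum>i<n. \<pi> x) \<le> (\<Sum>i<n. c * \<pi> (e i))"
    using assms by (intro sum_mono balanced e_mem) auto
  also have "\<dots> = c"
    using sum_path[of \<pi>] by (simp add: sum_stationary flip: sum_distrib_left)
  finally show ?thesis
    using n_pos by (simp add: field_simps)
qed

lemma stationary_ge:
  assumes "x \<in> V"
  shows "1 / (c * real n) \<le> \<pi> x"
proof -
  have "1 = (\<Sum>i<n. \<pi> (e i))"
    using sum_path[of \<pi>] by (simp add: sum_stationary)
  also have "\<dots> \<le> (\<Sum>i<n. c * \<pi> x)"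
    using assms by (intro sum_mono balanced e_mem) auto
  finally show ?thesis
    using n_pos c_ge_1 by (simp add: field_simps)
qed

text \<open>By invariance the drop in energy is the \<open>\<pi>\<close>-average of the variances of
  \<open>f\<close> under the rows of \<open>P\<close>. The row of \<open>m i\<close> has mass at
  least \<open>p\<close> at both ends of edge i, and \<open>\<pi>\<close> gives that row weight at
  least \<open>1 / (c * real n)\<close>. Injectivity of \<open>m\<close> prevents counting a row
  twice.\<close>

lemma energy_decrease:
  "p\<^sup>2 / (c * real n) * (\<Sum>i<n-1. (f (e (Suc i)) - f (e i))\<^sup>2) \<le>
    (\<Sum>x\<in>V. \<pi> x * (f x)\<^sup>2) - (\<Sum>x\<in>V. \<pi> x * (apply_kernel f x)\<^sup>2)"
proof -
  define v where "v x = apply_kernel (\<lambda>y. (f y)\<^sup>2) x - (apply_kernel f x)\<^sup>2" for x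
  have v_ge: "P x a * P x b * (f a - f b)\<^sup>2 \<le> v x" if "x \<in> V" "a \<in> V" "b \<in> V" for x a b
    unfolding v_def apply_kernel_def
    using that finite_V nonneg stochastic by (intro weighted_variance_ge) auto
  have v_nonneg: "0 \<le> v x" if "x \<in> V" for x
    using v_ge[of x x x] that by simp
  have "p\<^sup>2 / (c * real n) * (\<Sum>i<n-1. (f (e (Suc i)) - f (e i))\<^sup>2)
      \<le> (\<Sum>i<n-1. \<pi> (m i) * v (m i))"
    unfolding sum_distrib_left
  proof (rule sum_mono)
    fix i assume i: "i \<in> {..<n-1}"
    then have mem: "m i \<in> V" "e i \<in> V" "e (Suc i) \<in> V"
      using bridge_mem e_mem by auto
    have "p * p \<le> P (m i) (e (Suc i)) * P (m i) (e i)"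
      using i p bridge mem nonneg by (intro mult_mono) auto
    then have "p\<^sup>2 * (f (e (Suc i)) - f (e i))\<^sup>2 \<le> v (m i)"
      using v_ge[OF mem(1,3,2)] mult_right_mono[of "p * p" _ "(f (e (Suc i)) - f (e i))\<^sup>2"]
      by (fastforce simp: power2_eq_square)
    then have "1 / (c * real n) * (p\<^sup>2 * (f (e (Suc i)) - f (e i))\<^sup>2) \<le> \<pi> (m i) * v (m i)"
      using stationary_ge[OF mem(1)] pos[OF mem(1)] by (intro mult_mono) auto
    then show "p\<^sup>2 / (c * real n) * (f (e (Suc i)) - f (e i))\<^sup>2 \<le> \<pi> (m i) * v (m i)"
      by simp
  qed
  also have "\<dots> = (\<Sum>x\<in>m ` {..<n-1}. \<pi> x * v x)"
    by (subst sum.reindex[OF bridge_inj]) simp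
  also have "\<dots> \<le> (\<Sum>x\<in>V. \<pi> x * v x)"
    using finite_V bridge_mem v_nonneg
    by (intro sum_mono2) (auto intro!: mult_nonneg_nonneg stationary_nonneg)
  also have "\<dots> = (\<Sum>x\<in>V. \<pi> x * (f x)\<^sup>2) - (\<Sum>x\<in>V. \<pi> x * (apply_kernel f x)\<^sup>2)"
    using sum_apply_kernel[of "\<lambda>y. (f y)\<^sup>2"]
    by (simp add: v_def right_diff_distrib sum_subtractf)
  finally show ?thesis .
qed

text \<open>The exact constant of the cubic bound below: the factor
  \<open>p\<^sup>2 / (c * real n)\<close> of the energy estimate divided by the
  \<open>64 * c ^ 7 * real n\<close> left by the Nash inequality.\<close>

definition rate :: real where
  "rate = p\<^sup>2 / (64 * c ^ 8 * (real n)\<^sup>2)"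

lemma rate: "0 < rate" "rate \<le> 1"
proof -
  have "1 \<le> real n" "1 \<le> c ^ 8"
    using n_pos c_ge_1 by auto
  then have "1 * 1 \<le> (64 * c ^ 8) * (real n)\<^sup>2"
    by (intro mult_mono) auto
  moreover have "p\<^sup>2 \<le> 1"
    using p by (simp add: power_le_one)
  ultimately show "0 < rate" "rate \<le> 1"
    unfolding rate_def using p n_pos c_ge_1 by (auto simp: divide_le_eq_1 intro!: divide_pos_pos mult_pos_pos)
qed

text \<open>Both bounds come from the Nash inequality and differ in how the L1 norm \<open>A\<close>
  is controlled: the hypothesis \<open>L1\<close> gives the cubic decrement, Cauchy-Schwarz gives
  the linear one, which is a Poincare inequality.\<close>

lemma mean_zero_contraction:
  assumes mean: "(\<Sum>x\<in>V. \<pi> x * f x) = 0" and L1: "(\<Sum>x\<in>V. \<pi> x * \<bar>f x\<bar>) \<le> 2"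
  defines "a \<equiv> (\<Sum>x\<in>V. \<pi> x * (f x)\<^sup>2)"
  shows "(\<Sum>x\<in>V. \<pi> x * (apply_kernel f x)\<^sup>2) \<le> a - rate * a"
    and "(\<Sum>x\<in>V. \<pi> x * (apply_kernel f x)\<^sup>2) \<le> a - rate * a ^ 3"
proof -
  define h where "h i = f (e i)" for i
  define S D A where "S = (\<Sum>i<n. (h i)\<^sup>2)" and "D = (\<Sum>i<n-1. (h (Suc i) - h i)\<^sup>2)"
    and "A = (\<Sum>i<n. \<bar>h i\<bar>)"
  have N: "1 \<le> real n"
    using n_pos by simp
  have nonneg: "0 \<le> S" "0 \<le> D" "0 \<le> A" "0 \<le> a"
    by (auto simp: S_def D_def A_def a_def intro!: sum_nonneg mult_nonneg_nonneg stationary_nonneg)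
  have nash: "S ^ 3 \<le> 4 * D * A ^ 4"
    unfolding S_def D_def A_def
  proof (rule nash_inequality_path, rule ccontr)
    \<comment> \<open>If \<open>h i\<close> shared its strict sign with all values of
      \<open>f\<close>, the mean of \<open>f\<close> could not vanish.\<close>
    fix i assume i: "i < n" "\<not> (\<exists>j<n. h i * h j \<le> 0)"
    then have "0 < \<pi> x * (h i * f x)" if "x \<in> V" for x
      using that path pos[OF that] by (force simp: h_def bij_betw_def not_le)
    then have "0 < (\<Sum>x\<in>V. \<pi> x * (h i * f x))"
      using finite_V e_mem[OF i(1)] by (intro sum_pos) auto
    also have "\<dots> = h i * (\<Sum>x\<in>V. \<pi> x * f x)"
      by (simp add: sum_distrib_left algebra_simps)
    finally show False
      using mean by simp
  qed
  have S: "S = (\<Sum>x\<in>V. (f x)\<^sup>2)" and A: "A = (\<Sum>x\<in>V. \<bar>f x\<bar>)"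
    by (simp_all add: S_def A_def h_def sum_path[of "\<lambda>x. (f x)\<^sup>2"] sum_path[of "\<lambda>x. \<bar>f x\<bar>"])
  \<comment> \<open>The two-sided bounds on \<open>\<pi>\<close> translate weighted sums into the
    counting sums of the Nash inequality, at the cost of powers of \<open>c\<close>.\<close>
  have "a \<le> c / real n * S"
    unfolding a_def S sum_distrib_left by (intro sum_mono mult_right_mono stationary_le) auto
  then have aS: "real n * a / c \<le> S"
    using N c_ge_1 by (simp add: field_simps)
  have "1 / (c * real n) * A \<le> (\<Sum>x\<in>V. \<pi> x * \<bar>f x\<bar>)"
    unfolding A sum_distrib_left by (intro sum_mono mult_right_mono stationary_ge) auto
  with L1 have "1 / (c * real n) * A \<le> 2"
    by linarith
  then have A_le: "A \<le> 2 * c * real n"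
    using N c_ge_1 by (simp add: field_simps)
  have A2: "A\<^sup>2 \<le> real n * S"
    using Cauchy_Schwarz_ineq_sum[of "\<lambda>_. 1" "\<lambda>i. \<bar>h i\<bar>" "{..<n}"] by (simp add: A_def S_def)
  define E where "E = p\<^sup>2 / (c * real n) * D"
  have E: "(\<Sum>x\<in>V. \<pi> x * (apply_kernel f x)\<^sup>2) \<le> a - E"
    using energy_decrease[of f] by (simp add: E_def D_def h_def a_def)
  have coef: "0 \<le> p\<^sup>2 / (c * real n)"
    using c_ge_1 by simp
  have "rate * a ^ 3 \<le> E"
  proof -
    have "(real n * a / c) ^ 3 \<le> 4 * D * (2 * c * real n) ^ 4"
    proof -
      have "(real n * a / c) ^ 3 \<le> S ^ 3"
        using aS nonneg c_ge_1 by (intro power_mono) auto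
      also note nash
      also have "4 * D * A ^ 4 \<le> 4 * D * (2 * c * real n) ^ 4"
        using nonneg A_le by (intro mult_left_mono power_mono) auto
      finally show ?thesis .
    qed
    then have "(real n) ^ 3 * a ^ 3 \<le> (64 * c ^ 7 * (real n) ^ 4) * D"
      using c_ge_1 by (simp add: field_simps power_mult_distrib power_divide power_numeral_reduce)
    then have "a ^ 3 \<le> 64 * c ^ 7 * real n * D"
      using N by (simp add: power_numeral_reduce)
    then have "rate * a ^ 3 \<le> rate * (64 * c ^ 7 * real n * D)"
      using rate by (intro mult_left_mono) auto
    also have "\<dots> = E"
      using N c_ge_1 by (simp add: rate_def E_def field_simps power_numeral_reduce)
    finally show ?thesis .
  qed
  then show "(\<Sum>x\<in>V. \<pi> x * (apply_kernel f x)\<^sup>2) \<le> a - rate * a ^ 3"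
    using E by linarith
  have "rate * a \<le> E"
  proof -
    have "S ^ 3 \<le> 4 * D * (real n * S)\<^sup>2"
    proof -
      have "A ^ 4 = (A\<^sup>2)\<^sup>2"
        by simp
      also have "\<dots> \<le> (real n * S)\<^sup>2"
        using A2 by (intro power_mono) auto
      finally have "4 * D * A ^ 4 \<le> 4 * D * (real n * S)\<^sup>2"
        using nonneg by (intro mult_left_mono) auto
      with nash show ?thesis
        by linarith
    qed
    then have "S\<^sup>2 * S \<le> S\<^sup>2 * (4 * D * (real n)\<^sup>2)"
      by (simp add: power2_eq_square power3_eq_cube algebra_simps)
    moreover have "S \<le> 4 * D * (real n)\<^sup>2" if "S = 0"
      using that nonneg by simp
    ultimately have "S \<le> 4 * D * (real n)\<^sup>2"
      by (cases "S = 0") (auto simp: mult_le_cancel_left)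
    with aS have "real n * a / c \<le> 4 * D * (real n)\<^sup>2"
      by linarith
    then have "a \<le> 4 * c * real n * D"
      using N c_ge_1 by (simp add: field_simps power2_eq_square)
    then have "rate * a \<le> rate * (4 * c * real n * D)"
      using rate by (intro mult_left_mono) auto
    also have "\<dots> \<le> rate * (64 * c ^ 7 * real n * D)"
    proof -
      have "4 * c \<le> 64 * c ^ 7"
        using c_ge_1 power_increasing[of 1 7 c] by simp
      then show ?thesis
        using rate nonneg by (intro mult_left_mono mult_right_mono) auto
    qed
    also have "\<dots> = E"
      using N c_ge_1 by (simp add: rate_def E_def field_simps power_numeral_reduce)
    finally show ?thesis .
  qed
  then show "(\<Sum>x\<in>V. \<pi> x * (apply_kernel f x)\<^sup>2) \<le> a - rate * a"
    using E by linarith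
qed

text \<open>However concentrated the initial density is, \<open>u k - 1\<close> has mean zero and L1
  norm at most 2, so the contraction applies at every step. The abstract sequence \<open>u\<close>
  covers columns of powers of the chain as well as rows, which evolve under the reversal.\<close>

lemma density_chi_square_le:
  assumes nonneg: "\<And>k x. x \<in> V \<Longrightarrow> 0 \<le> u k x" and mass: "(\<Sum>x\<in>V. \<pi> x * u 0 x) = 1"
    and step: "\<And>k x. x \<in> V \<Longrightarrow> u (Suc k) x = apply_kernel (u k) x"
    and "0 \<le> L" "(2 + L) / rate \<le> real k"
  shows "(\<Sum>x\<in>V. \<pi> x * (u k x - 1)\<^sup>2) \<le> exp (- L)"
proof -
  let ?a = "\<lambda>k. \<Sum>x\<in>V. \<pi> x * (u k x - 1)\<^sup>2"
  have total: "(\<Sum>x\<in>V. \<pi> x * u k x) = 1" for k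
  proof (induction k)
    case (Suc k)
    have "(\<Sum>x\<in>V. \<pi> x * u (Suc k) x) = (\<Sum>x\<in>V. \<pi> x * apply_kernel (u k) x)"
      by (intro sum.cong) (auto simp: step)
    then show ?case
      using Suc by (simp add: sum_apply_kernel)
  qed (rule mass)
  have mean: "(\<Sum>x\<in>V. \<pi> x * (u k x - 1)) = 0" for k
    using total[of k] by (simp add: right_diff_distrib sum_subtractf sum_stationary)
  have L1: "(\<Sum>x\<in>V. \<pi> x * \<bar>u k x - 1\<bar>) \<le> 2" for k
  proof -
    have "(\<Sum>x\<in>V. \<pi> x * \<bar>u k x - 1\<bar>) \<le> (\<Sum>x\<in>V. \<pi> x * (u k x + 1))"
      using pos nonneg by (intro sum_mono mult_left_mono) (auto simp: abs_le_iff intro: less_imp_le)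
    also have "\<dots> = 2"
      by (simp add: distrib_left sum.distrib total sum_stationary)
    finally show ?thesis .
  qed
  have Suc: "?a (Suc k) = (\<Sum>x\<in>V. \<pi> x * (apply_kernel (\<lambda>y. u k y - 1) x)\<^sup>2)" for k
    by (intro sum.cong) (auto simp: step apply_kernel_diff_const)
  have "?a (Suc k) \<le> ?a k - rate * ?a k" "?a (Suc k) \<le> ?a k - rate * ?a k ^ 3" for k
    unfolding Suc using mean_zero_contraction[OF mean[of k] L1[of k]] by auto
  moreover have "0 \<le> ?a k" for k
    by (intro sum_nonneg mult_nonneg_nonneg stationary_nonneg) auto
  ultimately show ?thesis
    using rate assms by (intro cubic_then_exponential_decay[where r = rate and a = ?a])
qed

end

section \<open>Powers of a kernel and their densities\<close>

abbreviation kernel_power :: "'a set \<Rightarrow> 'a kernel \<Rightarrow> nat \<Rightarrow> 'a kernel" where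
  "kernel_power V P \<equiv> kernel_prod V (\<lambda>_. P)"

lemma kernel_power_add:
  assumes "finite V" "z \<in> V"
  shows "kernel_power V P (j + k) x z = (\<Sum>w\<in>V. kernel_power V P j x w * kernel_power V P k w z)"
  using assms(2)
proof (induction k arbitrary: z)
  case 0
  then show ?case
    using assms(1) by (simp add: if_distrib cong: if_cong)
next
  case (Suc k)
  have "kernel_power V P (j + Suc k) x z =
      (\<Sum>y\<in>V. \<Sum>w\<in>V. kernel_power V P j x w * (kernel_power V P k w y * P y z))"
    using Suc.IH by (simp add: kernel_mult_def sum_distrib_right mult.assoc)
  also have "\<dots> = (\<Sum>w\<in>V. kernel_power V P j x w * kernel_power V P (Suc k) w z)"
    by (subst sum.swap) (simp add: kernel_mult_def sum_distrib_left)
  finally show ?case .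
qed

context stationary_chain
begin

lemma kernel_power_nonneg:
  "x \<in> V \<Longrightarrow> y \<in> V \<Longrightarrow> 0 \<le> kernel_power V P k x y"
  by (induction k arbitrary: y) (auto simp: kernel_mult_def nonneg intro!: sum_nonneg)

lemma kernel_power_Suc_left:
  assumes "x \<in> V" "z \<in> V"
  shows "kernel_power V P (Suc k) x z = (\<Sum>w\<in>V. P x w * kernel_power V P k w z)"
proof -
  have "kernel_power V P 1 x w = P x w" for w
    using assms finite_V by (simp add: kernel_mult_def if_distrib[of "\<lambda>t. t * _"] cong: if_cong)
  then show ?thesis
    using kernel_power_add[OF finite_V assms(2), of P 1 k x] by simp
qed

lemma kernel_power_row_sum:
  assumes "x \<in> V"
  shows "(\<Sum>y\<in>V. kernel_power V P k x y) = 1"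
proof (induction k)
  case 0
  then show ?case
    using assms finite_V by simp
next
  case (Suc k)
  have "(\<Sum>y\<in>V. kernel_power V P (Suc k) x y) = (\<Sum>w\<in>V. kernel_power V P k x w * (\<Sum>y\<in>V. P w y))"
    unfolding kernel_prod.simps kernel_mult_def by (subst sum.swap) (simp add: sum_distrib_left)
  then show ?case
    using Suc by (simp add: stochastic)
qed

lemma kernel_power_invariant:
  assumes "z \<in> V"
  shows "(\<Sum>x\<in>V. \<pi> x * kernel_power V P k x z) = \<pi> z"
  using assms
proof (induction k arbitrary: z)
  case 0
  then show ?case
    using finite_V by (simp add: if_distrib cong: if_cong)
next
  case (Suc k)
  have "(\<Sum>x\<in>V. \<pi> x * kernel_power V P (Suc k) x z) =
      (\<Sum>w\<in>V. (\<Sum>x\<in>V. \<pi> x * kernel_power V P k x w) * P w z)"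
    unfolding kernel_prod.simps kernel_mult_def sum_distrib_left sum_distrib_right
    by (subst sum.swap) (simp add: mult.assoc)
  also have "\<dots> = (\<Sum>w\<in>V. \<pi> w * P w z)"
    using Suc.IH by simp
  also have "\<dots> = \<pi> z"
    using invariant Suc.prems by (simp add: invariant_prob_def)
  finally show ?case .
qed

text \<open>
  The density of the power \<open>2k\<close> minus one is the inner product in \<open>L\<^sup>2(\<pi>)\<close> of two centred
  densities of the power \<open>k\<close>, one evolving under the reversal and one under the chain itself.
\<close>

lemma kernel_power_density_le:
  assumes x: "x \<in> V" and z: "z \<in> V"
    and left: "(\<Sum>w\<in>V. \<pi> w * (kernel_power V P k x w / \<pi> w - 1)\<^sup>2) \<le> \<delta>"
    and right: "(\<Sum>w\<in>V. \<pi> w * (kernel_power V P k w z / \<pi> z - 1)\<^sup>2) \<le> \<delta>"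
  shows "\<bar>kernel_power V P (2 * k) x z / \<pi> z - 1\<bar> \<le> \<delta>"
proof -
  define u v where "u w = kernel_power V P k x w / \<pi> w" and "v w = kernel_power V P k w z / \<pi> z" for w
  have "kernel_power V P (2 * k) x z / \<pi> z = (\<Sum>w\<in>V. \<pi> w * u w * v w)"
    using kernel_power_add[OF finite_V z, of P k k x]
    by (simp add: mult_2 u_def v_def sum_divide_distrib) (auto intro!: sum.cong dest: pos)
  moreover have "(\<Sum>w\<in>V. \<pi> w * u w) = 1"
    using kernel_power_row_sum[OF x, of k] by (simp add: u_def) (smt (verit) pos sum.cong)
  moreover have "(\<Sum>w\<in>V. \<pi> w * v w) = 1"
    using kernel_power_invariant[OF z, of k] pos[OF z] by (simp add: v_def flip: sum_divide_distrib)
  ultimately have "kernel_power V P (2 * k) x z / \<pi> z - 1 = (\<Sum>w\<in>V. \<pi> w * (u w - 1) * (v w - 1))"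
    by (simp add: algebra_simps sum.distrib sum_subtractf sum_stationary)
  \<comment> \<open>Splitting the weight into two square roots turns the unweighted Cauchy-Schwarz
    inequality into the one of L2 of \<open>\<pi>\<close>.\<close>
  also have "\<dots> = (\<Sum>w\<in>V. (sqrt (\<pi> w) * (u w - 1)) * (sqrt (\<pi> w) * (v w - 1)))"
  proof (rule sum.cong[OF refl])
    fix w assume "w \<in> V"
    then have "(sqrt (\<pi> w) * sqrt (\<pi> w)) * (u w - 1) * (v w - 1) = \<pi> w * (u w - 1) * (v w - 1)"
      by (simp add: stationary_nonneg)
    then show "\<pi> w * (u w - 1) * (v w - 1) = (sqrt (\<pi> w) * (u w - 1)) * (sqrt (\<pi> w) * (v w - 1))"
      by (simp only: ac_simps)
  qed
  finally have "(kernel_power V P (2 * k) x z / \<pi> z - 1)\<^sup>2 \<le>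
      (\<Sum>w\<in>V. (sqrt (\<pi> w) * (u w - 1))\<^sup>2) * (\<Sum>w\<in>V. (sqrt (\<pi> w) * (v w - 1))\<^sup>2)"
    by (simp only: Cauchy_Schwarz_ineq_sum)
  also have "\<dots> = (\<Sum>w\<in>V. \<pi> w * (u w - 1)\<^sup>2) * (\<Sum>w\<in>V. \<pi> w * (v w - 1)\<^sup>2)"
    by (simp add: power_mult_distrib stationary_nonneg)
  also have "\<dots> \<le> \<delta> * \<delta>"
    using left right unfolding u_def v_def
    by (intro mult_mono) (auto intro!: sum_nonneg mult_nonneg_nonneg stationary_nonneg elim: order_trans[rotated])
  finally have "(kernel_power V P (2 * k) x z / \<pi> z - 1)\<^sup>2 \<le> \<delta>\<^sup>2"
    by (simp add: power2_eq_square)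
  moreover have "0 \<le> \<delta>"
    using left by (rule order_trans[rotated]) (auto intro!: sum_nonneg mult_nonneg_nonneg stationary_nonneg)
  ultimately show ?thesis
    using abs_le_square_iff[of _ \<delta>] by simp
qed

end

text \<open>Row densities \<open>kernel_power V P k x w / \<pi> w\<close> evolve in \<open>w\<close>
  under the reversal, column densities under \<open>P\<close> itself. The two chains may use
  different paths, but sharing \<open>n\<close>, \<open>p\<close> and \<open>c\<close> gives them
  the same rate.\<close>

lemma bridged_kernel_power_density_le:
  assumes fwd: "path_bridged_chain V P \<pi> e m n p c"
    and bwd: "path_bridged_chain V (stationary_chain.reversal P \<pi>) \<pi> e' m' n p c"
    and xz: "x \<in> V" "z \<in> V" and L: "0 \<le> L" "(2 + L) * (64 * c ^ 8 * (real n)\<^sup>2 / p\<^sup>2) \<le> real k"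
  shows "\<bar>kernel_power V P (2 * k) x z / \<pi> z - 1\<bar> \<le> exp (- L)"
proof -
  interpret F: path_bridged_chain V P \<pi> e m n p c by (rule fwd)
  interpret B: path_bridged_chain V F.reversal \<pi> e' m' n p c by (rule bwd)
  have k: "(2 + L) / F.rate \<le> real k" "(2 + L) / B.rate \<le> real k"
    using L(2) by (simp_all add: F.rate_def B.rate_def)
  show ?thesis
  proof (rule F.kernel_power_density_le[OF xz])
    show "(\<Sum>w\<in>V. \<pi> w * (kernel_power V P k x w / \<pi> w - 1)\<^sup>2) \<le> exp (- L)"
    proof (rule B.density_chi_square_le[where u = "\<lambda>k w. kernel_power V P k x w / \<pi> w"])
      show "0 \<le> kernel_power V P k x w / \<pi> w" if "w \<in> V" for k w
        using that xz F.kernel_power_nonneg F.stationary_nonneg by simp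
      show "(\<Sum>w\<in>V. \<pi> w * (kernel_power V P 0 x w / \<pi> w)) = 1"
        using F.kernel_power_row_sum[OF xz(1), of 0] by (smt (verit) F.pos nonzero_mult_div_cancel_left sum.cong times_divide_eq_right)
      show "kernel_power V P (Suc k) x w / \<pi> w =
          B.apply_kernel (\<lambda>w. kernel_power V P k x w / \<pi> w) w" if "w \<in> V" for k w
        using F.pos by (simp add: B.apply_kernel_def F.reversal_def kernel_mult_def sum_divide_distrib)
          (force intro!: sum.cong dest: F.pos)
    qed (use L k in auto)
    show "(\<Sum>w\<in>V. \<pi> w * (kernel_power V P k w z / \<pi> z - 1)\<^sup>2) \<le> exp (- L)"
    proof (rule F.density_chi_square_le[where u = "\<lambda>k w. kernel_power V P k w z / \<pi> z"])
      show "0 \<le> kernel_power V P k w z / \<pi> z" if "w \<in> V" for k w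
        using that xz F.kernel_power_nonneg F.stationary_nonneg by simp
      show "(\<Sum>w\<in>V. \<pi> w * (kernel_power V P 0 w z / \<pi> z)) = 1"
        using F.kernel_power_invariant[OF xz(2), of 0] F.pos[OF xz(2)] by (simp flip: sum_divide_distrib)
      show "kernel_power V P (Suc k) w z / \<pi> z =
          F.apply_kernel (\<lambda>w. kernel_power V P k w z / \<pi> z) w" if "w \<in> V" for k w
        using F.kernel_power_Suc_left[OF that xz(2)] by (simp add: F.apply_kernel_def sum_divide_distrib)
    qed (use L k in auto)
  qed
qed

section \<open>From density bounds to merging\<close>

text \<open>With both densities within \<open>\<delta>\<close> of one, their ratio differs from one
  by at most \<open>2 * \<delta>\<close> over \<open>1 - \<delta>\<close>. The reference
  \<open>\<rho>\<close> need not be invariant, so a measure moved by a permutation can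
  serve.\<close>

lemma rel_sup_dist_less:
  assumes "finite V" "V \<noteq> {}" and \<rho>: "\<And>z. z \<in> V \<Longrightarrow> 0 < \<rho> z"
    and close: "\<And>x z. x \<in> V \<Longrightarrow> z \<in> V \<Longrightarrow> \<bar>Q x z / \<rho> z - 1\<bar> \<le> \<delta>"
    and \<delta>: "\<delta> < 1" "2 * \<delta> / (1 - \<delta>) < \<eta>"
  shows "rel_sup_dist V Q < ereal \<eta>"
proof -
  have pos: "0 < Q y z" if "y \<in> V" "z \<in> V" for y z
  proof -
    have "0 < Q y z / \<rho> z"
      using close[OF that] \<delta>(1) by linarith
    then show ?thesis
      using \<rho>[OF that(2)] by (simp add: zero_less_divide_iff)
  qed
  have bound: "\<bar>Q x z / Q y z - 1\<bar> < \<eta>" if "x \<in> V" "y \<in> V" "z \<in> V" for x y z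
  proof -
    define a b where "a = Q x z / \<rho> z" and "b = Q y z / \<rho> z"
    have ab: "\<bar>a - 1\<bar> \<le> \<delta>" "\<bar>b - 1\<bar> \<le> \<delta>"
      unfolding a_def b_def using that close by auto
    have "Q x z / Q y z - 1 = (a - b) / b"
      using \<rho>[OF that(3)] pos[OF that(2,3)] by (simp add: a_def b_def field_simps)
    also have "\<bar>\<dots>\<bar> \<le> 2 * \<delta> / (1 - \<delta>)"
      unfolding abs_divide using ab \<delta>(1) by (intro frac_le) auto
    finally show ?thesis
      using \<delta>(2) by linarith
  qed
  define R where "R = (\<lambda>(x, y, z). \<bar>Q x z / Q y z - 1\<bar>) ` (V \<times> V \<times> V)"
  have R: "{\<bar>Q x z / Q y z - 1\<bar> | x y z. x \<in> V \<and> y \<in> V \<and> z \<in> V} = R"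
    by (force simp: R_def)
  have "Max R < \<eta>"
    using assms(1,2) bound by (subst Max_less_iff) (auto simp: R_def)
  moreover have "\<not> (\<exists>y\<in>V. \<exists>z\<in>V. Q y z = 0)"
    using pos by force
  ultimately show ?thesis
    by (simp add: rel_sup_dist_def R)
qed

text \<open>Factor \<open>Suc n\<close> is \<open>K\<close> conjugated by \<open>g ^^ n\<close>.
  Substituting \<open>g ^^ n\<close> in the intermediate sum leaves \<open>K\<close> followed by one
  application of \<open>g\<close>, so the conjugations telescope.\<close>

lemma shifted_kernel_prod:
  assumes g: "g permutes V"
  shows "x \<in> V \<Longrightarrow> y \<in> V \<Longrightarrow>
    kernel_prod V (\<lambda>i x y. K ((g ^^ (i - 1)) x) ((g ^^ (i - 1)) y)) n x y =
    kernel_power V (\<lambda>x y. K x (inv g y)) n x ((g ^^ n) y)"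
proof (induction n arbitrary: y)
  case 0
  then show ?case by simp
next
  case (Suc n)
  have bij: "bij_betw (g ^^ n) V V"
    using permutes_funpow[OF g] by (rule permutes_imp_bij)
  have "kernel_prod V (\<lambda>i x y. K ((g ^^ (i - 1)) x) ((g ^^ (i - 1)) y)) (Suc n) x y =
      (\<Sum>w\<in>V. kernel_power V (\<lambda>x y. K x (inv g y)) n x ((g ^^ n) w) * K ((g ^^ n) w) ((g ^^ n) y))"
    using Suc by (simp add: kernel_mult_def)
  also have "\<dots> = (\<Sum>w\<in>V. kernel_power V (\<lambda>x y. K x (inv g y)) n x w * K w ((g ^^ n) y))"
    by (rule sum.reindex_bij_betw[OF bij])
  also have "\<dots> = kernel_power V (\<lambda>x y. K x (inv g y)) (Suc n) x ((g ^^ Suc n) y)"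
    by (simp add: kernel_mult_def permutes_inverses[OF g])
  finally show ?case .
qed

section \<open>The odd cycle and its kernel\<close>

text \<open>Steps of length two around an odd cycle visit all vertices.
  \<open>odd_vertex N i\<close> is the common neighbour of \<open>even_vertex N i\<close> and its
  successor; even and odd describe the integers before reduction.\<close>

definition even_vertex :: "int \<Rightarrow> nat \<Rightarrow> int" where
  "even_vertex N i = (2 * int i) mod N"

definition odd_vertex :: "int \<Rightarrow> nat \<Rightarrow> int" where
  "odd_vertex N i = (2 * int i + 1) mod N"

text \<open>Two is invertible modulo an odd \<open>N\<close>. This is where the parity of
  \<open>N\<close> enters.\<close>

lemma inj_on_affine_mod:
  fixes N :: int
  assumes "odd N" "0 < N"
  shows "inj_on (\<lambda>i. (2 * int i + d) mod N) {..<nat N}"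
proof
  fix i j assume ij: "i \<in> {..<nat N}" "j \<in> {..<nat N}"
    and "(2 * int i + d) mod N = (2 * int j + d) mod N"
  then have "N dvd 2 * (int i - int j)"
    by (simp add: mod_eq_dvd_iff algebra_simps)
  moreover have "coprime N 2"
    using assms by simp
  ultimately have "N dvd int i - int j"
    using coprime_dvd_mult_right_iff by blast
  moreover have "\<bar>int i - int j\<bar> < \<bar>N\<bar>"
    using ij by auto
  ultimately have "int i - int j = 0"
    using dvd_imp_le_int[of "int i - int j" N] by fastforce
  then show "i = j" by simp
qed

lemma bij_betw_even_vertex:
  assumes "odd N" "0 < N"
  shows "bij_betw (even_vertex N) {..<nat N} (circle_verts N)"
proof -
  have inj: "inj_on (even_vertex N) {..<nat N}"
    using inj_on_affine_mod[OF assms, of 0] by (simp add: even_vertex_def[abs_def])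
  moreover have "even_vertex N ` {..<nat N} = circle_verts N"
    using assms card_image[OF inj]
    by (intro card_subset_eq) (auto simp: circle_verts_def even_vertex_def)
  ultimately show ?thesis
    by (simp add: bij_betw_def)
qed

lemma inj_on_odd_vertex:
  assumes "odd N" "0 < N"
  shows "inj_on (odd_vertex N) {..<nat N - 1}"
proof -
  have "inj_on (odd_vertex N) {..<nat N}"
    using inj_on_affine_mod[OF assms, of 1] by (simp add: odd_vertex_def[abs_def])
  then show ?thesis
    by (rule inj_on_subset) auto
qed

lemma odd_vertex_mem: "0 < N \<Longrightarrow> odd_vertex N i \<in> circle_verts N"
  by (simp add: odd_vertex_def circle_verts_def)

lemma circle_adj_sym: "circle_adj N x y \<longleftrightarrow> circle_adj N y x"
  using cong_minus_minus_iff[of "x - y" 1 N] cong_minus_minus_iff[of "x - y" "-1" N]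
  by (auto simp: circle_adj_def)

lemma circle_adj_odd_even:
  "circle_adj N (odd_vertex N i) (even_vertex N i)"
  "circle_adj N (odd_vertex N i) (even_vertex N (Suc i))"
  by (simp_all add: circle_adj_def odd_vertex_def even_vertex_def cong_def mod_diff_eq)

lemma circle_adj_iff:
  assumes "N \<ge> 3" "x \<in> circle_verts N" "y \<in> circle_verts N"
  shows "circle_adj N x y \<longleftrightarrow> y = (x + 1) mod N \<or> y = (x - 1) mod N"
proof -
  have y: "y = y mod N"
    using assms by (simp add: circle_verts_def)
  have "[x - y = d] (mod N) \<longleftrightarrow> y = (x - d) mod N" for d
  proof -
    have "[x - y = d] (mod N) \<longleftrightarrow> N dvd y - (x - d)"
      unfolding cong_iff_dvd_diff by (subst dvd_minus_iff[symmetric]) (simp add: algebra_simps)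
    also have "\<dots> \<longleftrightarrow> y mod N = (x - d) mod N"
      by (simp add: mod_eq_dvd_iff)
    finally show ?thesis
      using y by simp
  qed
  then show ?thesis
    by (auto simp: circle_adj_def)
qed

lemma circle_kernel_neighbours:
  assumes "\<epsilon> > 0" "N \<ge> 3" "x \<in> circle_verts N"
  shows "1 / (2 + \<epsilon>) \<le> circle_kernel \<epsilon> N x ((x + 1) mod N)"
    and "1 / (2 + \<epsilon>) \<le> circle_kernel \<epsilon> N x ((x - 1) mod N)"
    and "circle_kernel \<epsilon> N x ((x + 1) mod N) + circle_kernel \<epsilon> N x ((x - 1) mod N) = 1"
    and "(x + 1) mod N \<noteq> (x - 1) mod N"
proof -
  have mem: "(x + 1) mod N \<in> circle_verts N" "(x - 1) mod N \<in> circle_verts N"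
    using assms by (auto simp: circle_verts_def)
  have minus1: "-1 mod N = N - 1"
    using assms by (simp add: zmod_minus1)
  have small: "1 mod N = 1" "2 mod N = 2"
    using assms by auto
  have half: "1 / (2 + \<epsilon>) \<le> 1 / 2" "1 / (2 + \<epsilon>) \<le> (1 + \<epsilon>) / (2 + \<epsilon>)"
    "(1 + \<epsilon>) / (2 + \<epsilon>) + 1 / (2 + \<epsilon>) = 1"
    using assms(1) by (auto simp: field_simps)
  have adj: "circle_adj N x ((x + 1) mod N)" "circle_adj N x ((x - 1) mod N)"
    using circle_adj_iff[OF assms(2,3)] mem by auto
  consider "x = 0" | "x = 1" | "x \<notin> {0, 1}" by auto
  then have "1 / (2 + \<epsilon>) \<le> circle_kernel \<epsilon> N x ((x + 1) mod N) \<and>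
    1 / (2 + \<epsilon>) \<le> circle_kernel \<epsilon> N x ((x - 1) mod N) \<and>
    circle_kernel \<epsilon> N x ((x + 1) mod N) + circle_kernel \<epsilon> N x ((x - 1) mod N) = 1"
    using adj half small minus1 assms(2)
    by cases (auto simp: circle_kernel_def)
  then show "1 / (2 + \<epsilon>) \<le> circle_kernel \<epsilon> N x ((x + 1) mod N)"
    "1 / (2 + \<epsilon>) \<le> circle_kernel \<epsilon> N x ((x - 1) mod N)"
    "circle_kernel \<epsilon> N x ((x + 1) mod N) + circle_kernel \<epsilon> N x ((x - 1) mod N) = 1"
    by auto
  show "(x + 1) mod N \<noteq> (x - 1) mod N"
  proof
    assume "(x + 1) mod N = (x - 1) mod N"
    \<comment> \<open>The neighbours of a vertex differ by two, so they can only coincide if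
      \<open>N\<close> divides 2.\<close>
    then have "N dvd 2"
      by (simp add: mod_eq_dvd_iff)
    then show False
      using assms(2) zdvd_imp_le[of N 2] by simp
  qed
qed

lemma circle_kernel_ge:
  assumes "\<epsilon> > 0" "N \<ge> 3" "x \<in> circle_verts N" "y \<in> circle_verts N" "circle_adj N x y"
  shows "1 / (2 + \<epsilon>) \<le> circle_kernel \<epsilon> N x y"
  using circle_adj_iff[OF assms(2-4)] circle_kernel_neighbours[OF assms(1-3)] assms(5) by auto

lemma circle_kernel_nonneg: "\<epsilon> > 0 \<Longrightarrow> 0 \<le> circle_kernel \<epsilon> N x y"
  by (auto simp: circle_kernel_def)

lemma circle_kernel_row_sum:
  assumes "\<epsilon> > 0" "N \<ge> 3" "x \<in> circle_verts N"
  shows "(\<Sum>y\<in>circle_verts N. circle_kernel \<epsilon> N x y) = 1"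
proof -
  have "(\<Sum>y\<in>circle_verts N. circle_kernel \<epsilon> N x y) =
      (\<Sum>y\<in>{(x + 1) mod N, (x - 1) mod N}. circle_kernel \<epsilon> N x y)"
  proof (rule sum.mono_neutral_right)
    show "\<forall>y\<in>circle_verts N - {(x + 1) mod N, (x - 1) mod N}. circle_kernel \<epsilon> N x y = 0"
      using circle_adj_iff[OF assms(2,3)] by (auto simp: circle_kernel_def)
  qed (use assms in \<open>auto simp: circle_verts_def\<close>)
  then show ?thesis
    using circle_kernel_neighbours[OF assms] by simp
qed

section \<open>Merging for the circle kernel\<close>

text \<open>The general density bound is applied to the path of steps of length two, once for the
  chain and once for its reversal. The power \<open>c ^ 10\<close> collects \<open>c ^ 8\<close>
  from the rate and \<open>c\<^sup>2\<close> from the jump bound \<open>p\<close>.\<close>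

lemma circle_density_le:
  assumes eps: "\<epsilon> > 0" and c: "c \<ge> 1" and N: "odd N" "N \<ge> 3"
    and g: "g permutes circle_verts N"
    and inv: "invariant_prob (circle_verts N) (\<lambda>x y. circle_kernel \<epsilon> N x (inv g y)) \<pi>"
    and ratio: "Max (\<pi> ` circle_verts N) \<le> c * Min (\<pi> ` circle_verts N)"
    and xz: "x \<in> circle_verts N" "z \<in> circle_verts N"
    and L: "0 \<le> L" "(2 + L) * (64 * c ^ 10 * (2 + \<epsilon>)\<^sup>2 * (real_of_int N)\<^sup>2) \<le> real k"
  shows "0 < \<pi> z"
    and "\<bar>kernel_power (circle_verts N) (\<lambda>x y. circle_kernel \<epsilon> N x (inv g y)) (2 * k) x z / \<pi> z - 1\<bar> \<le> exp (- L)"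
proof -
  define V where "V = circle_verts N"
  define P where "P = (\<lambda>x y. circle_kernel \<epsilon> N x (inv g y))"
  \<comment> \<open>The least edge weight is \<open>1 / (2 + \<epsilon>)\<close>; reversing the
    chain costs a further factor \<open>c\<close>, so this \<open>p\<close> serves both
    directions.\<close>
  define p where "p = 1 / ((2 + \<epsilon>) * c)"
  note g = g[folded V_def] and inv = inv[folded V_def P_def] and ratio = ratio[folded V_def]
    and xz = xz[folded V_def]
  have fin: "finite V"
    by (simp add: V_def circle_verts_def)
  have balanced: "\<pi> x \<le> c * \<pi> y" if "x \<in> V" "y \<in> V" for x y
  proof -
    have "\<pi> x \<le> Max (\<pi> ` V)" "Min (\<pi> ` V) \<le> \<pi> y"
      using that fin by auto
    with ratio show ?thesis
      using c mult_left_mono[of "Min (\<pi> ` V)" "\<pi> y" c] by linarith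
  qed
  have nonneg: "0 \<le> \<pi> x" if "x \<in> V" for x
    using inv that by (simp add: invariant_prob_def)
  have pos: "0 < \<pi> x" if "x \<in> V" for x
  proof (rule ccontr)
    assume "\<not> 0 < \<pi> x"
    \<comment> \<open>A single zero would spread to all states through \<open>balanced\<close>,
      against total mass one.\<close>
    then have "\<pi> y = 0" if "y \<in> V" for y
      using nonneg[OF \<open>x \<in> V\<close>] nonneg[OF that] balanced[OF that \<open>x \<in> V\<close>] by simp
    then show False
      using inv by (simp add: invariant_prob_def)
  qed
  then show "0 < \<pi> z"
    using xz by simp
  have p: "0 < p" "p \<le> 1" "p \<le> 1 / (2 + \<epsilon>)"
  proof -
    have le: "(2 + \<epsilon>) * 1 \<le> (2 + \<epsilon>) * c"
      using eps c by (intro mult_left_mono) auto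
    have "1 \<le> (2 + \<epsilon>) * c"
      using mult_mono[of 1 "2 + \<epsilon>" 1 c] eps c by simp
    with le show "0 < p" "p \<le> 1" "p \<le> 1 / (2 + \<epsilon>)"
      unfolding p_def using eps c by (auto intro!: divide_left_mono)
  qed
  have even_mem: "even_vertex N i \<in> V" and odd_mem: "odd_vertex N i \<in> V" for i
    using N by (auto simp: V_def circle_verts_def even_vertex_def odd_vertex_def)
  have g_mem: "g x \<in> V \<longleftrightarrow> x \<in> V" for x
    using permutes_in_image[OF g] .
  have chain: "stationary_chain V P \<pi>"
  proof
    show "(\<Sum>y\<in>V. P x y) = 1" if "x \<in> V" for x
    proof -
      have "(\<Sum>y\<in>V. P x y) = (\<Sum>y\<in>V. circle_kernel \<epsilon> N x y)"
        unfolding P_def using permutes_imp_bij[OF permutes_inv[OF g]]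
        by (rule sum.reindex_bij_betw)
      then show ?thesis
        using circle_kernel_row_sum[OF eps N(2)] that by (simp add: V_def)
    qed
  qed (use fin pos inv eps in \<open>auto simp: P_def circle_kernel_nonneg\<close>)
  interpret stationary_chain V P \<pi> by (rule chain)
  interpret R: stationary_chain V reversal \<pi> by (rule stationary_chain_reversal)
  have adj: "circle_adj N (odd_vertex N i) (even_vertex N i)"
    "circle_adj N (odd_vertex N i) (even_vertex N (Suc i))"
    "circle_adj N (even_vertex N i) (odd_vertex N i)"
    "circle_adj N (even_vertex N (Suc i)) (odd_vertex N i)" for i
    using circle_adj_odd_even circle_adj_sym by blast+
  have P_g: "1 / (2 + \<epsilon>) \<le> P x (g y)" if "x \<in> V" "y \<in> V" "circle_adj N x y" for x y
    using circle_kernel_ge[OF eps N(2)] that by (simp add: P_def V_def permutes_inverses[OF g])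
  \<comment> \<open>Since \<open>P x (g y)\<close> is the circle kernel at (x,y), an odd vertex
    jumps to the \<open>g\<close>-images of its two neighbours; the path is therefore carried along
    by \<open>g\<close>.\<close>
  have fwd: "path_bridged_chain V P \<pi> (g \<circ> even_vertex N) (odd_vertex N) (nat N) p c"
  proof
    show "bij_betw (g \<circ> even_vertex N) {..<nat N} V"
      using bij_betw_even_vertex[of N] permutes_imp_bij[OF g] N
      by (auto simp: V_def intro: bij_betw_trans)
    show "inj_on (odd_vertex N) {..<nat N - 1}"
      using inj_on_odd_vertex[of N] N by simp
    show "p \<le> P (odd_vertex N i) ((g \<circ> even_vertex N) i)" for i
      using P_g[OF odd_mem even_mem adj(1)] p(3) by (metis comp_apply order_trans)
    show "p \<le> P (odd_vertex N i) ((g \<circ> even_vertex N) (Suc i))" for i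
      using P_g[OF odd_mem even_mem adj(2)] p(3) by (metis comp_apply order_trans)
  qed (use p balanced odd_mem in auto)
  have rev_g: "p \<le> reversal (g y) x" if "x \<in> V" "y \<in> V" "circle_adj N x y" for x y
  proof -
    have "\<pi> (g y) \<le> c * \<pi> x" "0 < \<pi> (g y)" "0 < \<pi> x"
      using that balanced pos g_mem by auto
    then have "1 / c \<le> \<pi> x / \<pi> (g y)"
      using c by (simp add: field_simps)
    then have "1 / c * (1 / (2 + \<epsilon>)) \<le> \<pi> x / \<pi> (g y) * P x (g y)"
      using P_g[OF that] eps c \<open>0 < \<pi> x\<close> \<open>0 < \<pi> (g y)\<close> by (intro mult_mono) auto
    then show ?thesis
      by (simp add: reversal_def p_def mult.commute)
  qed
  \<comment> \<open>Backwards, the \<open>g\<close>-image of an odd vertex jumps to the two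
    neighbours themselves, so here \<open>g\<close> moves the bridges and not the path.\<close>
  have bwd: "path_bridged_chain V reversal \<pi> (even_vertex N) (g \<circ> odd_vertex N) (nat N) p c"
  proof
    show "bij_betw (even_vertex N) {..<nat N} V"
      using bij_betw_even_vertex[of N] N by (simp add: V_def)
    show "inj_on (g \<circ> odd_vertex N) {..<nat N - 1}"
      using inj_on_odd_vertex[of N] N permutes_inj_on[OF g] by (simp add: comp_inj_on)
    show "(g \<circ> odd_vertex N) ` {..<nat N - 1} \<subseteq> V"
      using odd_mem g_mem by auto
    show "p \<le> reversal ((g \<circ> odd_vertex N) i) (even_vertex N i)" for i
      using rev_g[OF even_mem odd_mem adj(3)] by simp
    show "p \<le> reversal ((g \<circ> odd_vertex N) i) (even_vertex N (Suc i))" for i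
      using rev_g[OF even_mem odd_mem adj(4)] by simp
  qed (use p balanced in auto)
  have "64 * c ^ 8 * (real (nat N))\<^sup>2 / p\<^sup>2 = 64 * c ^ 8 * (real_of_int N)\<^sup>2 * ((2 + \<epsilon>) * c)\<^sup>2"
    using N by (simp add: p_def power_divide)
  also have "\<dots> = 64 * (c ^ 8 * c\<^sup>2) * (2 + \<epsilon>)\<^sup>2 * (real_of_int N)\<^sup>2"
    by (simp only: power_mult_distrib ac_simps)
  also have "c ^ 8 * c\<^sup>2 = c ^ 10"
    by (simp flip: power_add)
  finally have "64 * c ^ 8 * (real (nat N))\<^sup>2 / p\<^sup>2 = 64 * c ^ 10 * (2 + \<epsilon>)\<^sup>2 * (real_of_int N)\<^sup>2" .
  with L show "\<bar>kernel_power (circle_verts N) (\<lambda>x y. circle_kernel \<epsilon> N x (inv g y)) (2 * k) x z / \<pi> z - 1\<bar>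
      \<le> exp (- L)"
    using bridged_kernel_power_density_le[OF fwd bwd xz L(1), of k] by (simp add: V_def P_def)
qed

theorem theorem5p1:
  fixes \<epsilon> c :: real
  assumes "\<epsilon> > 0" and "c \<ge> 1"
  shows "\<exists>C::real. \<forall>(N::int) (l::int) (g :: int \<Rightarrow> int) (\<pi> :: int \<Rightarrow> real).
    N = 2 * l + 1 \<and> N \<ge> 3 \<and>
    g permutes circle_verts N \<and>
    invariant_prob (circle_verts N) (\<lambda>x y. circle_kernel \<epsilon> N x (inv g y)) \<pi> \<and>
    Max (\<pi> ` circle_verts N) \<le> c * Min (\<pi> ` circle_verts N) \<longrightarrow>
    (\<forall>\<eta>::real. \<eta> > 0 \<longrightarrow>
       ereal_of_enat (rel_sup_merging_time (circle_verts N)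
           (\<lambda>i x y. circle_kernel \<epsilon> N ((g ^^ (i - 1)) x) ((g ^^ (i - 1)) y)) \<eta>)
         \<le> ereal (C * (real_of_int N)\<^sup>2 * (1 + log_plus (1 / \<eta>))))"
proof -
  define B where "B = 64 * c ^ 10 * (2 + \<epsilon>)\<^sup>2"
  \<comment> \<open>The 2 accounts for the power \<open>2 * k\<close>. In the 3, two units come from
    the decay estimate and one from rounding \<open>k\<close> up; \<open>ln 8\<close> comes from
    \<open>L\<close>.\<close>
  define C where "C = 2 * B * (3 + ln 8)"
  have "1 * 1 * 1 \<le> 64 * c ^ 10 * (2 + \<epsilon>)\<^sup>2"
    using assms by (intro mult_mono one_le_power) auto
  then have B: "1 \<le> B"
    by (simp add: B_def)
  have "ereal_of_enat (rel_sup_merging_time (circle_verts N)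
           (\<lambda>i x y. circle_kernel \<epsilon> N ((g ^^ (i - 1)) x) ((g ^^ (i - 1)) y)) \<eta>)
         \<le> ereal (C * (real_of_int N)\<^sup>2 * (1 + log_plus (1 / \<eta>)))"
    if N: "N = 2 * l + 1" "N \<ge> 3" and g: "g permutes circle_verts N"
      and inv: "invariant_prob (circle_verts N) (\<lambda>x y. circle_kernel \<epsilon> N x (inv g y)) \<pi>"
      and ratio: "Max (\<pi> ` circle_verts N) \<le> c * Min (\<pi> ` circle_verts N)"
      and \<eta>: "\<eta> > 0" for N l g \<pi> \<eta>
  proof -
    let ?V = "circle_verts N" and ?P = "\<lambda>x y. circle_kernel \<epsilon> N x (inv g y)"
    let ?K = "\<lambda>i x y. circle_kernel \<epsilon> N ((g ^^ (i - 1)) x) ((g ^^ (i - 1)) y)"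
    \<comment> \<open>This makes \<open>exp (- L)\<close> equal to an eighth of the minimum of 1 and
      \<open>\<eta>\<close>, whence \<open>2 * \<delta> / (1 - \<delta>)\<close> is at most
      \<open>2 * \<eta> / 7\<close>.\<close>
    define L where "L = ln 8 + log_plus (1 / \<eta>)"
    define k where "k = nat \<lceil>(2 + L) * (B * (real_of_int N)\<^sup>2)\<rceil>"
    define \<delta> where "\<delta> = exp (- L)"
    have lp: "0 \<le> log_plus (1 / \<eta>)" "ln (1 / \<eta>) \<le> log_plus (1 / \<eta>)"
      by (auto simp: log_plus_def)
    have "(0::real) \<le> ln 8"
      by simp
    then have L: "0 \<le> L"
      using lp by (simp add: L_def)
    have BN: "1 \<le> B * (real_of_int N)\<^sup>2"
      using mult_mono[OF B, of 1 "(real_of_int N)\<^sup>2"] B N(2) by simp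
    have "0 \<le> (2 + L) * (B * (real_of_int N)\<^sup>2)"
      using L BN by simp
    then have k: "(2 + L) * (B * (real_of_int N)\<^sup>2) \<le> real k"
      "real k \<le> (2 + L) * (B * (real_of_int N)\<^sup>2) + 1"
      by (auto simp: k_def of_nat_ceiling)
    have \<delta>: "\<delta> \<le> 1 / 8" "\<delta> \<le> \<eta> / 8"
    proof -
      have "\<delta> \<le> exp (- ln 8)"
        unfolding \<delta>_def L_def using lp by simp
      then show "\<delta> \<le> 1 / 8"
        by (simp add: exp_minus)
      have "\<delta> \<le> exp (- ln 8 - ln (1 / \<eta>))"
        unfolding \<delta>_def L_def using lp by simp
      also have "\<dots> = \<eta> / 8"
        using \<eta> by (simp add: exp_diff exp_minus ln_div)
      finally show "\<delta> \<le> \<eta> / 8" .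
    qed
    have odd: "odd N"
      using N by simp
    have g_mem: "(g ^^ j) z \<in> ?V" if "z \<in> ?V" for j z
      using permutes_in_image[OF permutes_funpow[OF g]] that by blast
    have close: "0 < \<pi> z" "\<bar>kernel_power ?V ?P (2 * k) x z / \<pi> z - 1\<bar> \<le> \<delta>"
      if "x \<in> ?V" "z \<in> ?V" for x z
      using circle_density_le[OF assms odd N(2) g inv ratio that L, of k] k(1)
      by (simp_all add: B_def \<delta>_def)
    have "rel_sup_dist ?V (kernel_prod ?V ?K (2 * k)) < ereal \<eta>"
    \<comment> \<open>At time \<open>2 * k\<close> the product compares with \<open>\<pi>\<close>
      moved by \<open>g ^^ (2 * k)\<close>, by the telescoping of the conjugations.\<close>
    proof (rule rel_sup_dist_less[where \<rho> = "\<lambda>z. \<pi> ((g ^^ (2 * k)) z)" and \<delta> = \<delta>])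
      show "\<bar>kernel_prod ?V ?K (2 * k) x z / \<pi> ((g ^^ (2 * k)) z) - 1\<bar> \<le> \<delta>"
        if "x \<in> ?V" "z \<in> ?V" for x z
        using close(2)[OF that(1) g_mem[OF that(2)]] shifted_kernel_prod[OF g that] by simp
      show "0 < \<pi> ((g ^^ (2 * k)) z)" if "z \<in> ?V" for z
        using close(1) g_mem that by blast
      have "2 * \<delta> / (1 - \<delta>) \<le> 2 * (\<eta> / 8) / (7 / 8)"
        using \<delta> \<eta> by (intro frac_le) auto
      also have "\<dots> < \<eta>"
        using \<eta> by simp
      finally show "2 * \<delta> / (1 - \<delta>) < \<eta>" .
      have "0 \<in> ?V"
        using N by (simp add: circle_verts_def)
      then show "?V \<noteq> {}"
        by blast
    qed (use \<delta> in \<open>auto simp: circle_verts_def\<close>)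
    then have "rel_sup_merging_time ?V ?K \<eta> \<le> enat (2 * k)"
      unfolding rel_sup_merging_time_def by (intro Inf_lower) blast
    then have "ereal_of_enat (rel_sup_merging_time ?V ?K \<eta>) \<le> ereal_of_enat (enat (2 * k))"
      by (simp only: ereal_of_enat_le_iff)
    also have "\<dots> = ereal (2 * real k)"
      by simp
    also have "2 * real k \<le> C * (real_of_int N)\<^sup>2 * (1 + log_plus (1 / \<eta>))"
    proof -
      have "3 + L \<le> (3 + ln 8) * (1 + log_plus (1 / \<eta>))"
        using lp by (simp add: L_def algebra_simps)
      then have "(3 + L) * (B * (real_of_int N)\<^sup>2)
          \<le> (3 + ln 8) * (1 + log_plus (1 / \<eta>)) * (B * (real_of_int N)\<^sup>2)"
        using BN by (intro mult_right_mono) auto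
      moreover have "real k \<le> (3 + L) * (B * (real_of_int N)\<^sup>2)"
        using k(2) BN by (simp add: algebra_simps)
      ultimately show ?thesis
        by (simp add: C_def algebra_simps)
    qed
    finally show ?thesis
      by simp
  qed
  then show ?thesis
    by blast
qed

end
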